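(* Let $(\mathbb{T},\log,\partial,\circ,x)$, with $\mathbb{T}=\mathbf{R}[[\mathfrak{N}]]$, be a structure satisfying conditions (i)–(viii) of the context, and assume that any two $f,g\in\mathbb{T}^{>\mathbf{R}}$ with $f,g>x$ are conjugate in the group $(\mathbb{T}^{>\mathbf{R}},\circ,x)$. For $f\in\mathbb{T}^{>\mathbf{R}}$ let $\mathcal{C}(f)=\{h\in\mathbb{T}^{>\mathbf{R}}:h\circ f=f\circ h\}$. Then for all $f,g\in\mathbb{T}^{>\mathbf{R}}$ with $f,g>x$: (1) if $f>h$ for all $h\in\mathcal{C}(g)$, then $f\circ g>g\circ f$; (2) if $f\geqslant g$, then for every $g_0\in\mathcal{C}(g)$ there is an $f_0\in\mathcal{C}(f)$ with $f_0\geqslant g_0$.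
   Context: Well-based series. The set theory is NBG; groups and fields may be proper classes. For an ordered field $\mathbf{R}$ and a linearly ordered abelian group $(\mathfrak{N},\cdot,1,\prec)$, $\mathbf{R}[[\mathfrak{N}]]$ is the ordered field of functions $s:\mathfrak{N}\to\mathbf{R}$ whose support $\operatorname{supp}s$ is a set well-ordered for $\succ$, with pointwise sum and Cauchy product; $s>0$ iff $s\neq0$ and $s(\max\operatorname{supp}s)>0$. Monomials (elements of $\mathfrak{N}$) and elements of $\mathbf{R}$ are identified with series. For $s\neq0$, $\mathfrak{d}(s)=\max\operatorname{supp}s$. $s\prec t$ means $r|s|<|t|$ for all $r\in\mathbf{R}^{>}$; $s\preccurlyeq t$ means not $t\prec s$. $\mathbb{T}_{\succ}=\{s:\operatorname{supp}s\succ1\}$ and $\mathbb{T}^{>\mathbf{R}}=\mathbb{T}^{>,\succ}=\{s:s>\mathbf{R}\}$. A family $(s_i)$ is summable if $\bigcup_i\operatorname{supp}s_i$ is a set well-ordered by $\succ$ and each monomial lies in finitely many $\operatorname{supp}s_i$; an $\mathbf{R}$-linear map is strongly linear if it preserves summability and commutes with sums of summable families. When $\log$ is given, for $s,t\in\mathbb{T}^\times$: $s\prec\!\!\prec t$ iff $\log|s|\prec\log|t|$; $s\preccurlyeq\!\!\preccurlyeq t$ iff $\log|s|\preccurlyeq\log|t|$. Write $f'=\partial(f)$, $f^{(k)}=\partial^k(f)$. Conditions. (i) $\mathfrak{N}$ is a linearly ordered abelian group, $\mathbf{R}$ an ordered field, $\mathbb{T}=\mathbf{R}[[\mathfrak{N}]]$.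 (ii) $(\mathbb{T},\log)$ is an exponentially closed transserial field: $\log:(\mathbb{T}^{>},\cdot,1,<)\to(\mathbb{T},+,0,<)$ is an isomorphism of ordered groups, $\log\mathfrak{N}\subseteq\mathbb{T}_{\succ}$, $\log s\leqslant s-1$ for $s\in\mathbb{T}^{>}$, $\log(1+\varepsilon)=\sum_{k>0}\frac{(-1)^{k+1}}{k}\varepsilon^k$ for $\varepsilon\prec1$, and $\log$ restricts to an isomorphism $(\mathbf{R}^{>},\cdot,<)\to(\mathbf{R},+,<)$. (iii) $\partial:\mathbb{T}\to\mathbb{T}$ is a surjective transserial derivation (strongly linear, Leibniz rule, $\partial(\log|s|)=\partial(s)/s$ for $s\neq0$), with identity $x\in\mathfrak{N}$ ($x>0$, $x \neq 1$, $\partial(x)=1$), which is flat: for $\mathfrak{m}\in\mathfrak{N}$ and $\mathfrak{n}\in\operatorname{supp}\partial(\mathfrak{m})$ there are $\mathfrak{f},\mathfrak{w}\in\mathfrak{N}$ with $\mathfrak{f}\prec\!\!\prec\mathfrak{m}$, $\mathfrak{w}\preccurlyeq\!\!\preccurlyeq x$, $\mathfrak{n}=\mathfrak{m}\mathfrak{f}\mathfrak{w}$. (iv) $(\mathbb{T},\partial)$ is an H-field: $\ker\partial=\mathbf{R}$ and $f'>0$ for $f\in\mathbb{T}^{>,\succ}$. (v) $\circ:\mathbb{T}\times\mathbb{T}^{>,\succ}\to\mathbb{T}$ is a transserial composition law (each $f\mapsto f\circ s$ is a strongly linear morphism of ordered rings commuting with $\log$, and $f\circ(s\circ t)=(f\circ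 s)\circ t$) with identity $x$ ($x\circ s=s$, $f\circ x=f$), which is flat: for $s\in\mathbb{T}^{>,\succ}$, $\mathfrak{m}\in\mathfrak{N}\setminus\{1\}$, $\mathfrak{n}\in\operatorname{supp}(\mathfrak{m}\circ s)$ there are $\mathfrak{f},\mathfrak{w}\in\mathfrak{N}$, $\mathfrak{u}\in\operatorname{supp}s$ with $\mathfrak{f}\prec\!\!\prec\mathfrak{m}$, $\mathfrak{w}\preccurlyeq1$, $\mathfrak{w}\preccurlyeq\!\!\preccurlyeq\mathfrak{u}$, $\mathfrak{n}=\mathfrak{d}(\mathfrak{m}\circ s)\mathfrak{f}\mathfrak{w}$. (vi) Chain rule $(f\circ s)'=s'(f'\circ s)$; and Taylor expansions: whenever $s\in\mathbb{T}^{>,\succ}$, $\delta\prec s$, and $(\mathfrak{m}'\circ s)\delta\prec\mathfrak{m}\circ s$ for all $\mathfrak{m}\in\operatorname{supp}f$, the family $((\mathfrak{m}^{(k)}\circ s)\delta^k)_{\mathfrak{m}\in\operatorname{supp}f,k\in\mathbb{N}}$ is summable, $f\circ(s+\delta)=\sum_k\frac{f^{(k)}\circ s}{k!}\delta^k=\sum_{\mathfrak{m},k}f(\mathfrak{m})\frac{\mathfrak{m}^{(k)}\circ s}{k!}\delta^k$, and $(f^{(k)}\circ s)\delta^k\succ(f^{(k+1)}\circ s)\delta^{k+1}$ whenever the left side is nonzero. (vii) $(\mathbb{T}^{>,\succ},\circ,x)$ is a group. (viii) Monotonicity: for $f\in\mathbb{T}\setminus\mathbf{R}$, the map $s\mapsto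 f\circ s$ on $\mathbb{T}^{>,\succ}$ is strictly increasing if $f'>0$ and strictly decreasing if $f'<0$. Under these conditions $(\mathbb{T}^{>\mathbf{R}},\circ,x,<)$ is a linearly bi-ordered group. Elements $f,g$ are conjugate if $h\circ f=g\circ h$ for some $h\in\mathbb{T}^{>\mathbf{R}}$. *)

theory Defs
  imports "HOL-Algebra.Group" "HOL-Library.Infinite_Typeclass"
begin

unbundle cardinal_syntax

section \<open>Well-based series\<close>

text \<open>
  The monomial group is an arbitrary type of class \<^class>\<open>linordered_ab_group_add\<close>, hence is
  written additively: the product of monomials is \<open>+\<close>, the monomial \<open>1\<close> is \<open>0\<close>, and the
  dominance order is \<open><\<close>.

  Sets versus proper classes: classes are rendered by HOL types, and a type \<open>'v\<close> plays the role of
  the class of all sets. By limitation of size, a class is a set iff it is strictly smaller than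
  the universe. Without such a bound on the supports there is no exponentially closed
  transserial field at all: a nontrivial field of all well-based series over a fixed set of
  monomials admits no logarithm as in
  \<open>exp_closed_transserial_field\<close> below (Kuhlmann, Kuhlmann and Shelah).
\<close>

definition small :: "'v itself \<Rightarrow> 'a set \<Rightarrow> bool" where
  "small _ A \<longleftrightarrow> |A| <o |UNIV :: 'v set|"

text \<open>
  Of the universe of sets only the following is retained: it is uncountable and regular (replacement).
  This covers the universes of strongly inaccessible size as well as, for a given set of
  monomials, any sufficiently large regular bound.
\<close>

definition set_universe :: "'v itself \<Rightarrow> bool" where
  "set_universe _ \<longleftrightarrow> natLeq <o |UNIV :: 'v set| \<and> regularCard |UNIV :: 'v set|"

abbreviation well_based :: "'m::linorder set \<Rightarrow> bool" where
  "well_based A \<equiv> wfp_on A (>)"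

lemma small_subset: "small V B \<Longrightarrow> A \<subseteq> B \<Longrightarrow> small V A"
  unfolding small_def using card_of_mono1 ordLeq_ordLess_trans by blast

lemma small_empty: "small (V :: 'v itself) {}"
  unfolding small_def
  by (metis UNIV_not_empty card_of_Well_order card_of_empty3 not_ordLeq_iff_ordLess)

lemma small_finite: "finite A \<Longrightarrow> small (V :: 'v::infinite itself) A"
  unfolding small_def by (rule finite_ordLess_infinite)
    (simp_all add: infinite_UNIV Field_card_of card_of_Well_order card_of_well_order_on)

lemma small_Un: "small (V :: 'v::infinite itself) A \<Longrightarrow> small V B \<Longrightarrow> small V (A \<union> B)"
  unfolding small_def by (simp add: card_of_Un_ordLess_infinite infinite_UNIV)

lemma small_image: "small V A \<Longrightarrow> small V (f ` A)"
  unfolding small_def using card_of_image ordLeq_ordLess_trans by blast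

lemma small_Times:
  assumes "small (V :: 'v::infinite itself) A" "small V B"
  shows "small V (A \<times> B)"
proof (cases "finite (A <+> B)")
  case True
  then show ?thesis by (intro small_finite) simp
next
  case inf: False
  have *: "|A <+> B| <o |UNIV :: 'v set|"
    using assms unfolding small_def by (intro card_of_Plus_ordLess_infinite infinite_UNIV)
  have "A \<times> B \<subseteq> (\<lambda>(p, q). (projl p, projr q)) ` ((A <+> B) \<times> (A <+> B))"
    by force
  then have "|A \<times> B| \<le>o |(A <+> B) \<times> (A <+> B)|"
    by (meson surj_imp_ordLeq)
  also have "|(A <+> B) \<times> (A <+> B)| =o |A <+> B|"
    using inf by (rule card_of_Times_same_infinite)
  also note *
  finally show ?thesis unfolding small_def .
qed

lemma well_based_iff:
  "well_based A \<longleftrightarrow> \<not> (\<exists>f :: nat \<Rightarrow> 'm::linorder. range f \<subseteq> A \<and> strict_mono f)"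
proof
  assume wb: "well_based A"
  show "\<not> (\<exists>f :: nat \<Rightarrow> 'm. range f \<subseteq> A \<and> strict_mono f)"
  proof
    assume "\<exists>f :: nat \<Rightarrow> 'm. range f \<subseteq> A \<and> strict_mono f"
    then obtain f :: "nat \<Rightarrow> 'm" where f: "range f \<subseteq> A" "strict_mono f" by blast
    obtain z where "z \<in> range f" "\<forall>y. y > z \<longrightarrow> y \<notin> range f"
      using wb f(1) unfolding wfp_on_iff_ex_minimal by (metis empty_not_UNIV image_is_empty)
    then obtain n where "\<forall>y. y > f n \<longrightarrow> y \<notin> range f" by blast
    then show False using f(2) by (metis lessI rangeI strict_mono_def)
  qed
next
  assume no: "\<not> (\<exists>f :: nat \<Rightarrow> 'm. range f \<subseteq> A \<and> strict_mono f)"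
  show "well_based A"
    unfolding wfp_on_iff_ex_minimal
  proof (intro allI impI)
    fix B assume B: "B \<subseteq> A" "B \<noteq> {}"
    show "\<exists>z\<in>B. \<forall>y. y > z \<longrightarrow> y \<notin> B"
    proof (rule ccontr)
      assume "\<not> (\<exists>z\<in>B. \<forall>y. y > z \<longrightarrow> y \<notin> B)"
      then have "\<forall>z\<in>B. \<exists>y. y > z \<and> y \<in> B" by blast
      then obtain g where g: "\<And>z. z \<in> B \<Longrightarrow> g z > z \<and> g z \<in> B" by metis
      obtain b where "b \<in> B" using B by blast
      define f where "f n = (g ^^ n) b" for n
      have "f n \<in> B" for n unfolding f_def by (induction n) (use \<open>b \<in> B\<close> g in auto)
      moreover have "f n < f (Suc n)" for n using g calculation by (simp add: f_def)
      ultimately show False using no B(1) by (metis image_subsetI strict_mono_Suc_iff subsetD)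
    qed
  qed
qed

lemma well_based_empty: "well_based {}"
  by (simp add: wfp_on_def)

lemma well_based_singleton: "well_based {m :: 'm::linorder}"
  by (auto simp: wfp_on_iff_ex_minimal subset_singleton_iff)

lemma well_based_max:
  assumes "well_based (A :: 'm::linorder set)" "A \<noteq> {}"
  shows "\<exists>m\<in>A. \<forall>n\<in>A. n \<le> m"
  using assms unfolding wfp_on_iff_ex_minimal by (metis not_le subset_refl)

lemma well_based_Un:
  assumes "well_based (A :: 'm::linorder set)" "well_based B"
  shows "well_based (A \<union> B)"
  unfolding wfp_on_iff_ex_minimal
proof (intro allI impI)
  fix C assume C: "C \<subseteq> A \<union> B" "C \<noteq> {}"
  have A: "C \<inter> A \<noteq> {} \<Longrightarrow> \<exists>m\<in>C \<inter> A. \<forall>n\<in>C \<inter> A. n \<le> m"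
    by (rule well_based_max[OF wfp_on_subset[OF assms(1)]]) auto
  have B: "C \<inter> B \<noteq> {} \<Longrightarrow> \<exists>m\<in>C \<inter> B. \<forall>n\<in>C \<inter> B. n \<le> m"
    by (rule well_based_max[OF wfp_on_subset[OF assms(2)]]) auto
  have "\<exists>m\<in>C. \<forall>n\<in>C. n \<le> m"
  proof (cases "C \<inter> A = {} \<or> C \<inter> B = {}")
    case True
    then show ?thesis using A B C by blast
  next
    case False
    then obtain a b where "a \<in> C \<inter> A" "\<forall>n\<in>C \<inter> A. n \<le> a" "b \<in> C \<inter> B" "\<forall>n\<in>C \<inter> B. n \<le> b"
      using A B by blast
    then have "max a b \<in> C" "\<forall>n\<in>C. n \<le> max a b"
      using C(1) by (auto simp: max_def) (meson UnE IntI order_trans linear subsetD)+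
    then show ?thesis by blast
  qed
  then show "\<exists>z\<in>C. \<forall>y. z < y \<longrightarrow> y \<notin> C" by (meson not_le)
qed

lemma well_based_seq:
  fixes f :: "nat \<Rightarrow> 'm::linorder"
  assumes "well_based A" "\<And>n. f n \<in> A"
  obtains g :: "nat \<Rightarrow> nat" where "strict_mono g" "antimono (\<lambda>n. f (g n))"
proof -
  obtain g :: "nat \<Rightarrow> nat" where g: "strict_mono g" "monoseq (\<lambda>n. f (g n))"
    using seq_monosub by blast
  show ?thesis
  proof (cases "antimono (\<lambda>n. f (g n))")
    case True
    then show ?thesis using g(1) that by blast
  next
    case False
    then have mono: "mono (\<lambda>n. f (g n))" using g(2) by (auto simp: monoseq_iff)
    define B where "B = range (\<lambda>n. f (g n))"
    have "\<exists>m\<in>B. \<forall>n\<in>B. n \<le> m"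
      by (rule well_based_max[OF wfp_on_subset[OF assms(1)]]) (use assms(2) in \<open>auto simp: B_def\<close>)
    then obtain N where N: "\<And>n. f (g n) \<le> f (g N)" unfolding B_def by blast
    have eq: "f (g (N + n)) = f (g N)" for n
      using N monoD[OF mono, of N "N + n"] by (simp add: antisym)
    have "strict_mono (\<lambda>n. g (N + n))" using g(1) by (simp add: strict_mono_def)
    moreover have "antimono (\<lambda>n. f (g (N + n)))" by (simp add: eq monotone_def)
    ultimately show ?thesis by (rule that)
  qed
qed

lemma well_based_plus:
  fixes A B :: "'m::linordered_ab_group_add set"
  assumes "well_based A" "well_based B"
  shows "well_based ((\<lambda>(a, b). a + b) ` (A \<times> B))"
  unfolding well_based_iff
proof
  assume "\<exists>f :: nat \<Rightarrow> 'm. range f \<subseteq> (\<lambda>(a, b). a + b) ` (A \<times> B) \<and> strict_mono f"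
  then obtain f :: "nat \<Rightarrow> 'm"
    where f: "range f \<subseteq> (\<lambda>(a, b). a + b) ` (A \<times> B)" "strict_mono f" by blast
  then have "\<forall>n. \<exists>a b. a \<in> A \<and> b \<in> B \<and> f n = a + b" by fastforce
  then obtain a b where ab: "\<And>n. a n \<in> A" "\<And>n. b n \<in> B" "\<And>n. f n = a n + b n" by metis
  obtain g :: "nat \<Rightarrow> nat" where g: "strict_mono g" "antimono (\<lambda>n. a (g n))"
    using well_based_seq[of A a] assms(1) ab(1) by blast
  have "b (g m) < b (g n)" if "m < n" for m n
  proof -
    have "a (g m) + b (g m) < a (g n) + b (g n)"
      using f(2) g(1) that ab(3) by (metis strict_monoD)
    moreover have "a (g n) \<le> a (g m)" using antimonoD[OF g(2)] that by simp
    ultimately show ?thesis using add_mono[of "a (g n)" "a (g m)" "b (g n)" "b (g m)"]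
      by (meson leD leI)
  qed
  then have "strict_mono (\<lambda>n. b (g n))" by (simp add: strict_mono_def)
  moreover have "range (\<lambda>n. b (g n)) \<subseteq> B" using ab(2) by blast
  ultimately show False using assms(2) unfolding well_based_iff by metis
qed

lemma well_based_plus_finite:
  fixes A B :: "'m::linordered_ab_group_add set"
  assumes "well_based A" "well_based B"
  shows "finite {(a, b). a \<in> A \<and> b \<in> B \<and> a + b = m}" (is "finite ?P")
proof (rule ccontr)
  assume "infinite ?P"
  then obtain p :: "nat \<Rightarrow> 'm \<times> 'm" where p: "inj p" "range p \<subseteq> ?P"
    using infinite_countable_subset by blast
  define a where "a n = fst (p n)" for n
  have pn: "p n = (a n, m - a n)" "a n \<in> A" "m - a n \<in> B" for n
    using p(2) by (auto simp: a_def prod_eq_iff range_subsetD dest!: range_subsetD[of p _ n]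
        split: prod.splits)
  have inj: "a i \<noteq> a j" if "i \<noteq> j" for i j using p(1) that pn(1) by (metis injD)
  obtain g :: "nat \<Rightarrow> nat" where g: "strict_mono g" "antimono (\<lambda>n. a (g n))"
    using well_based_seq[of A a] assms(1) pn(2) by blast
  have "m - a (g i) < m - a (g j)" if "i < j" for i j
  proof -
    have "a (g j) \<le> a (g i)" using antimonoD[OF g(2)] that by simp
    moreover have "a (g j) \<noteq> a (g i)" using inj that g(1) by (metis nat_neq_iff strict_monoD)
    ultimately show ?thesis by simp
  qed
  then have "strict_mono (\<lambda>n. m - a (g n))" by (simp add: strict_mono_def)
  moreover have "range (\<lambda>n. m - a (g n)) \<subseteq> B" using pn(3) by blast
  ultimately show False using assms(2) unfolding well_based_iff by metis
qed

typedef (overloaded) ('m::linorder, 'r::zero, 'v) series =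
  "{s :: 'm \<Rightarrow> 'r. well_based {m. s m \<noteq> 0} \<and> small TYPE('v) {m. s m \<noteq> 0}}"
  morphisms coeff Abs_series
  by (rule exI[of _ "\<lambda>_. 0"]) (simp add: small_empty well_based_empty)

definition supp :: "('m::linorder, 'r::zero, 'v) series \<Rightarrow> 'm set" where
  "supp s = {m. coeff s m \<noteq> 0}"

definition dominant :: "('m::linorder, 'r::zero, 'v) series \<Rightarrow> 'm" where
  "dominant s = (GREATEST m. m \<in> supp s)"

lemma well_based_supp: "well_based (supp s)"
  and small_supp: "small TYPE('v) (supp (s :: ('m::linorder, 'r::zero, 'v) series))"
  using coeff[of s] by (auto simp: supp_def)

lemma series_eqI: "(\<And>m. coeff s m = coeff t m) \<Longrightarrow> s = t"
  by (simp add: coeff_inject[symmetric] ext)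

lemma coeff_Abs_series:
  fixes f :: "'m::linorder \<Rightarrow> 'r::zero"
  assumes "{m. f m \<noteq> 0} \<subseteq> A" "well_based A" "small TYPE('v) A"
  shows "coeff (Abs_series f :: ('m, 'r, 'v) series) = f"
  using assms by (intro Abs_series_inverse) (auto intro: wfp_on_subset small_subset)

instantiation series :: (linordered_ab_group_add, comm_ring_1, infinite) comm_ring_1
begin

definition "0 = Abs_series (\<lambda>_. 0)"

definition "1 = Abs_series (\<lambda>m. if m = 0 then 1 else 0)"

definition "s + t = Abs_series (\<lambda>m. coeff s m + coeff t m)"

definition "- s = Abs_series (\<lambda>m. - coeff s m)"

definition "s - t = Abs_series (\<lambda>m. coeff s m - coeff t m)"

definition
  "s * t = Abs_series (\<lambda>m. \<Sum>(a, b) | a \<in> supp s \<and> b \<in> supp t \<and> a + b = m. coeff s a * coeff t b)"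

lemma coeff_zero: "coeff (0 :: ('a, 'b, 'c) series) m = 0"
  unfolding zero_series_def by (subst coeff_Abs_series[of _ "{}"]) (auto intro: small_empty well_based_empty)

lemma coeff_one: "coeff (1 :: ('a, 'b, 'c) series) m = (if m = 0 then 1 else 0)"
  unfolding one_series_def
  by (subst coeff_Abs_series[of _ "{0}"])
    (auto intro: small_finite well_based_singleton)

lemma coeff_add: "coeff (s + t :: ('a, 'b, 'c) series) m = coeff s m + coeff t m"
  unfolding plus_series_def
  by (subst coeff_Abs_series[of _ "supp s \<union> supp t"])
    (auto intro: small_Un well_based_Un simp: well_based_supp small_supp, auto simp: supp_def)

lemma coeff_uminus: "coeff (- s :: ('a, 'b, 'c) series) m = - coeff s m"
  unfolding uminus_series_def
  by (subst coeff_Abs_series[of _ "supp s"])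
    (auto simp: well_based_supp small_supp, auto simp: supp_def)

lemma coeff_diff: "coeff (s - t :: ('a, 'b, 'c) series) m = coeff s m - coeff t m"
  unfolding minus_series_def
  by (subst coeff_Abs_series[of _ "supp s \<union> supp t"])
    (auto intro: small_Un well_based_Un simp: well_based_supp small_supp, auto simp: supp_def)

lemma coeff_mult_supp:
  "coeff (s * t :: ('a, 'b, 'c) series) m =
    (\<Sum>(a, b) | a \<in> supp s \<and> b \<in> supp t \<and> a + b = m. coeff s a * coeff t b)"
proof -
  let ?f = "\<lambda>m. \<Sum>(a, b) | a \<in> supp s \<and> b \<in> supp t \<and> a + b = m. coeff s a * coeff t b"
  have "{m. ?f m \<noteq> 0} \<subseteq> (\<lambda>(a, b). a + b) ` (supp s \<times> supp t)"
  proof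
    fix m assume "m \<in> {m. ?f m \<noteq> 0}"
    then have "?f m \<noteq> 0" by simp
    then show "m \<in> (\<lambda>(a, b). a + b) ` (supp s \<times> supp t)"
      by (rule sum.not_neutral_contains_not_neutral) force
  qed
  then have "coeff (Abs_series ?f :: ('a, 'b, 'c) series) = ?f"
    by (rule coeff_Abs_series)
      (intro well_based_plus small_image small_Times well_based_supp small_supp)+
  then show ?thesis unfolding times_series_def by simp
qed

lemma coeff_mult:
  assumes "supp s \<subseteq> A" "supp t \<subseteq> B" "well_based A" "well_based B"
  shows "coeff (s * t :: ('a, 'b, 'c) series) m =
    (\<Sum>(a, b) | a \<in> A \<and> b \<in> B \<and> a + b = m. coeff s a * coeff t b)"
  unfolding coeff_mult_supp
  by (rule sum.mono_neutral_left[OF well_based_plus_finite[OF assms(3,4)]])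
    (use assms(1,2) in \<open>auto simp: supp_def\<close>)

lemma supp_mult: "supp (s * t :: ('a, 'b, 'c) series) \<subseteq> (\<lambda>(a, b). a + b) ` (supp s \<times> supp t)"
proof
  fix m assume "m \<in> supp (s * t)"
  then have "(\<Sum>(a, b) | a \<in> supp s \<and> b \<in> supp t \<and> a + b = m. coeff s a * coeff t b) \<noteq> 0"
    by (simp add: supp_def[of "s * t"] coeff_mult_supp)
  then show "m \<in> (\<lambda>(a, b). a + b) ` (supp s \<times> supp t)"
    by (rule sum.not_neutral_contains_not_neutral) force
qed

lemma mult_commute_series: "s * t = t * (s :: ('a, 'b, 'c) series)"
proof (rule series_eqI)
  fix m
  show "coeff (s * t) m = coeff (t * s) m"
    unfolding coeff_mult_supp
    by (rule sum.reindex_bij_witness[of _ prod.swap prod.swap]) (auto simp: ac_simps)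
qed

lemma coeff_mult3:
  fixes s t u :: "('a, 'b, 'c) series"
  shows "coeff (s * t * u) m =
    (\<Sum>(a, b, c) | a \<in> supp s \<and> b \<in> supp t \<and> c \<in> supp u \<and> a + b + c = m.
        coeff s a * coeff t b * coeff u c)"
proof -
  let ?S = "(\<lambda>(a, b). a + b) ` (supp s \<times> supp t)"
  let ?P = "{(p, c). p \<in> ?S \<and> c \<in> supp u \<and> p + c = m}"
  let ?Q = "\<lambda>x. {(a, b). a \<in> supp s \<and> b \<in> supp t \<and> a + b = fst x}"
  have wb: "well_based ?S" by (intro well_based_plus well_based_supp)
  have fin: "finite ?P" by (intro well_based_plus_finite wb well_based_supp)
  have fin': "finite (?Q x)" for x by (intro well_based_plus_finite well_based_supp)
  have "coeff (s * t * u) m = (\<Sum>(p, c)\<in>?P. coeff (s * t) p * coeff u c)"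
    by (rule coeff_mult[OF supp_mult order_refl wb well_based_supp])
  also have "\<dots> = (\<Sum>x\<in>?P. \<Sum>y\<in>?Q x. coeff s (fst y) * coeff t (snd y) * coeff u (snd x))"
    by (intro sum.cong) (auto simp: coeff_mult_supp sum_distrib_right split_def intro!: sum.cong)
  also have "\<dots> = (\<Sum>(x, y)\<in>Sigma ?P ?Q. coeff s (fst y) * coeff t (snd y) * coeff u (snd x))"
    using fin fin' by (intro sum.Sigma) auto
  also have "\<dots> = (\<Sum>(a, b, c) | a \<in> supp s \<and> b \<in> supp t \<and> c \<in> supp u \<and> a + b + c = m.
        coeff s a * coeff t b * coeff u c)"
    by (rule sum.reindex_bij_witness[of _ "\<lambda>(a, b, c). ((a + b, c), (a, b))"
          "\<lambda>((p, c), (a, b)). (a, b, c)"]) (auto simp: image_iff)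
  finally show ?thesis .
qed

instance
proof
  fix s t u :: "('a, 'b, 'c) series"
  show "s + t + u = s + (t + u)" "s + t = t + s" "0 + s = s" "- s + s = 0" "s - t = s + - t"
    by (auto intro!: series_eqI simp: coeff_add coeff_zero coeff_uminus coeff_diff ac_simps)
  show "(0 :: ('a, 'b, 'c) series) \<noteq> 1"
    by (metis coeff_zero coeff_one zero_neq_one)
  show "s * t = t * s" by (rule mult_commute_series)
  have "coeff (s * t * u) m = coeff (t * u * s) m" for m
    unfolding coeff_mult3
    by (rule sum.reindex_bij_witness[of _ "\<lambda>(b, c, a). (a, b, c)" "\<lambda>(a, b, c). (b, c, a)"])
      (auto simp: ac_simps)
  then have "s * t * u = t * u * s" by (rule series_eqI)
  then show "s * t * u = s * (t * u)" by (simp add: mult_commute_series)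
  show "1 * s = s"
  proof (rule series_eqI)
    fix m
    have "coeff (1 * s) m =
      (\<Sum>(a, b) | a \<in> {0} \<and> b \<in> supp s \<and> a + b = m. coeff 1 a * coeff s b)"
      by (rule coeff_mult) (auto simp: supp_def[of 1] coeff_one well_based_supp
          well_based_singleton split: if_splits)
    also have "{(a, b). a \<in> {0} \<and> b \<in> supp s \<and> a + b = m} = (if m \<in> supp s then {(0, m)} else {})"
      by auto
    finally show "coeff (1 * s) m = coeff s m" by (auto simp: coeff_one supp_def)
  qed
  show "(s + t) * u = s * u + t * u"
  proof (rule series_eqI)
    fix m
    let ?P = "{(a, b). a \<in> supp s \<union> supp t \<and> b \<in> supp u \<and> a + b = m}"
    have wb: "well_based (supp s \<union> supp t)" by (intro well_based_Un well_based_supp)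
    have eq: "coeff (r * u) m = (\<Sum>(a, b)\<in>?P. coeff r a * coeff u b)"
      if "supp r \<subseteq> supp s \<union> supp t" for r :: "('a, 'b, 'c) series"
      by (rule coeff_mult[OF that order_refl wb well_based_supp])
    have "supp (s + t) \<subseteq> supp s \<union> supp t" by (auto simp: supp_def coeff_add)
    then show "coeff ((s + t) * u) m = coeff (s * u + t * u) m"
      by (simp add: eq coeff_add split_def distrib_right sum.distrib)
  qed
qed

end

lemma dominant_unique:
  "m \<in> supp s \<Longrightarrow> (\<And>n. n \<in> supp s \<Longrightarrow> n \<le> m) \<Longrightarrow> dominant s = m"
  unfolding dominant_def by (rule Greatest_equality)

lemma dominant:
  fixes s :: "('m::linordered_ab_group_add, 'r::comm_ring_1, 'v::infinite) series"
  assumes "s \<noteq> 0"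
  shows dominant_in_supp: "dominant s \<in> supp s"
    and le_dominant: "\<And>m. m \<in> supp s \<Longrightarrow> m \<le> dominant s"
proof -
  have "supp s \<noteq> {}" using assms by (auto simp: supp_def coeff_zero intro: series_eqI)
  then obtain d where d: "d \<in> supp s" "\<And>m. m \<in> supp s \<Longrightarrow> m \<le> d"
    using well_based_max[OF well_based_supp] by blast
  have "dominant s = d" using d by (rule dominant_unique)
  then show "dominant s \<in> supp s" "\<And>m. m \<in> supp s \<Longrightarrow> m \<le> dominant s"
    using d by simp_all
qed

definition pos_series ::
    "('m::linordered_ab_group_add, 'r::linordered_field, 'v::infinite) series \<Rightarrow> bool" where
  "pos_series s \<longleftrightarrow> s \<noteq> 0 \<and> coeff s (dominant s) > 0"

lemma pos_series_add:
  assumes "pos_series s" "pos_series t"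
  shows "pos_series (s + t)"
proof -
  let ?m = "max (dominant s) (dominant t)"
  have s: "s \<noteq> 0" "coeff s (dominant s) > 0" and t: "t \<noteq> 0" "coeff t (dominant t) > 0"
    using assms by (auto simp: pos_series_def)
  have s0: "coeff s m = 0" if "dominant s < m" for m
    using le_dominant[OF s(1), of m] that by (force simp: supp_def)
  have t0: "coeff t m = 0" if "dominant t < m" for m
    using le_dominant[OF t(1), of m] that by (force simp: supp_def)
  have pos: "coeff (s + t) ?m > 0"
    using s t s0[of "dominant t"] t0[of "dominant s"]
    by (cases "dominant s" "dominant t" rule: linorder_cases) (auto simp: coeff_add max_def)
  have "dominant (s + t) = ?m"
  proof (rule dominant_unique)
    show "?m \<in> supp (s + t)" using pos by (simp add: supp_def)
    show "n \<le> ?m" if "n \<in> supp (s + t)" for n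
    proof (rule ccontr)
      assume "\<not> n \<le> ?m"
      then have "dominant s < n" "dominant t < n" by (simp_all add: le_max_iff_disj not_le)
      then have "coeff (s + t) n = 0" by (simp add: coeff_add s0 t0)
      then show False using that by (simp add: supp_def)
    qed
  qed
  then show ?thesis using pos by (auto simp: pos_series_def coeff_zero)
qed

lemma pos_series_mult:
  assumes "pos_series s" "pos_series t"
  shows "pos_series (s * t)"
proof -
  let ?a = "dominant s" and ?b = "dominant t"
  have s: "s \<noteq> 0" "coeff s ?a > 0" and t: "t \<noteq> 0" "coeff t ?b > 0"
    using assms by (auto simp: pos_series_def)
  have "{(a, b). a \<in> supp s \<and> b \<in> supp t \<and> a + b = ?a + ?b} = {(?a, ?b)}"
  proof -
    have "a = ?a \<and> b = ?b" if "a \<in> supp s" "b \<in> supp t" "a + b = ?a + ?b" for a b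
      using le_dominant[OF s(1) that(1)] le_dominant[OF t(1) that(2)] that(3)
      by (metis add_le_imp_le_left add_le_imp_le_right add_left_mono add_right_mono antisym)
    then show ?thesis using dominant_in_supp[OF s(1)] dominant_in_supp[OF t(1)] by blast
  qed
  then have c: "coeff (s * t) (?a + ?b) > 0"
    using s t by (simp add: coeff_mult_supp)
  have "dominant (s * t) = ?a + ?b"
  proof (rule dominant_unique)
    show "?a + ?b \<in> supp (s * t)" using c by (simp add: supp_def)
    show "n \<le> ?a + ?b" if "n \<in> supp (s * t)" for n
      using that supp_mult[of s t] le_dominant[OF s(1)] le_dominant[OF t(1)]
      by (auto intro!: add_mono)
  qed
  then show ?thesis using c by (auto simp: pos_series_def coeff_zero)
qed

lemma pos_series_uminus: "s \<noteq> 0 \<Longrightarrow> pos_series s \<or> pos_series (- s)"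
proof -
  assume "s \<noteq> 0"
  moreover have "supp (- s) = supp s" by (simp add: supp_def coeff_uminus)
  then have "dominant (- s) = dominant s" by (simp add: dominant_def)
  ultimately show ?thesis
    using dominant_in_supp[of s] by (auto simp: pos_series_def supp_def coeff_uminus)
qed

lemma not_pos_series_zero: "\<not> pos_series 0"
  by (simp add: pos_series_def)

instantiation series :: (linordered_ab_group_add, linordered_field, infinite) linordered_idom
begin

definition "s < t \<longleftrightarrow> pos_series (t - s)"

definition "s \<le> t \<longleftrightarrow> s = t \<or> pos_series (t - s)"

definition "\<bar>s :: ('a, 'b, 'c) series\<bar> = (if s < 0 then - s else s)"

definition "sgn (s :: ('a, 'b, 'c) series) = (if s = 0 then 0 else if 0 < s then 1 else - 1)"

instance
proof
  fix s t u :: "('a, 'b, 'c) series"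
  have asym: "\<not> (pos_series (t - s) \<and> pos_series (s - t))"
    using pos_series_add[of "t - s" "s - t"] by (auto simp: not_pos_series_zero)
  show "s < t \<longleftrightarrow> s \<le> t \<and> \<not> t \<le> s"
    using asym by (auto simp: less_series_def less_eq_series_def not_pos_series_zero)
  show "s \<le> s" by (simp add: less_eq_series_def)
  show "s \<le> t \<Longrightarrow> t \<le> u \<Longrightarrow> s \<le> u"
    using pos_series_add[of "t - s" "u - t"] by (auto simp: less_eq_series_def)
  show "s \<le> t \<Longrightarrow> t \<le> s \<Longrightarrow> s = t"
    using asym by (auto simp: less_eq_series_def)
  show "s \<le> t \<Longrightarrow> u + s \<le> u + t" by (simp add: less_eq_series_def)
  show "s \<le> t \<or> t \<le> s"
    using pos_series_uminus[of "t - s"] by (auto simp: less_eq_series_def)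
  show "s < t \<Longrightarrow> 0 < u \<Longrightarrow> u * s < u * t"
    using pos_series_mult[of u "t - s"] by (simp add: less_series_def right_diff_distrib)
  show "\<bar>s\<bar> = (if s < 0 then - s else s)" by (rule abs_series_def)
  show "sgn s = (if s = 0 then 0 else if 0 < s then 1 else - 1)" by (rule sgn_series_def)
qed

end

definition monomial ::
    "'m \<Rightarrow> ('m::linordered_ab_group_add, 'r::linordered_field, 'v::infinite) series" where
  "monomial m = Abs_series (\<lambda>n. if n = m then 1 else 0)"

definition const ::
    "'r \<Rightarrow> ('m::linordered_ab_group_add, 'r::linordered_field, 'v::infinite) series" where
  "const r = Abs_series (\<lambda>n. if n = 0 then r else 0)"

lemma coeff_monomial: "coeff (monomial m) n = (if n = m then 1 else 0)"
  unfolding monomial_def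
  by (subst coeff_Abs_series[of _ "{m}"])
    (auto intro: small_finite well_based_singleton)

lemma coeff_const: "coeff (const r) n = (if n = 0 then r else 0)"
  unfolding const_def
  by (subst coeff_Abs_series[of _ "{0}"])
    (auto intro: small_finite well_based_singleton)

definition dom_less (infix "\<prec>" 50) where
  "s \<prec> t \<longleftrightarrow>
    (\<forall>r>0. const r * \<bar>s\<bar> <
      \<bar>t :: ('m::linordered_ab_group_add, 'r::linordered_field, 'v::infinite) series\<bar>)"

abbreviation dom_le (infix "\<preceq>" 50) where
  "s \<preceq> t \<equiv> \<not> t \<prec> s"

definition pos_infinite ::
    "('m::linordered_ab_group_add, 'r::linordered_field, 'v::infinite) series set" where
  "pos_infinite = {s. \<forall>r. const r < s}"

definition summable_family ::
    "'i set \<Rightarrow> ('i \<Rightarrow> ('m::linorder, 'r::zero, 'v) series) \<Rightarrow> bool" where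
  "summable_family I s \<longleftrightarrow>
    small TYPE('v) (\<Union>i\<in>I. supp (s i)) \<and> well_based (\<Union>i\<in>I. supp (s i)) \<and>
    (\<forall>m. finite {i \<in> I. m \<in> supp (s i)})"

definition family_sum ::
    "'i set \<Rightarrow> ('i \<Rightarrow> ('m::linorder, 'r::comm_monoid_add, 'v) series) \<Rightarrow> ('m, 'r, 'v) series" where
  "family_sum I s = Abs_series (\<lambda>m. \<Sum>i | i \<in> I \<and> m \<in> supp (s i). coeff (s i) m)"

definition has_family_sum ::
    "'i set \<Rightarrow> ('i \<Rightarrow> ('m::linorder, 'r::comm_monoid_add, 'v) series) \<Rightarrow> ('m, 'r, 'v) series \<Rightarrow> bool" where
  "has_family_sum I s t \<longleftrightarrow> summable_family I s \<and> family_sum I s = t"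

lemma coeff_family_sum:
  fixes s :: "'i \<Rightarrow> ('m::linorder, 'r::comm_monoid_add, 'v) series"
  assumes "summable_family I s"
  shows "coeff (family_sum I s) m = (\<Sum>i | i \<in> I \<and> m \<in> supp (s i). coeff (s i) m)"
proof -
  let ?f = "\<lambda>m. \<Sum>i | i \<in> I \<and> m \<in> supp (s i). coeff (s i) m"
  have "{m. ?f m \<noteq> 0} \<subseteq> (\<Union>i\<in>I. supp (s i))"
  proof
    fix m assume "m \<in> {m. ?f m \<noteq> 0}"
    then have "?f m \<noteq> 0" by simp
    then show "m \<in> (\<Union>i\<in>I. supp (s i))"
      by (rule sum.not_neutral_contains_not_neutral) blast
  qed
  then have "coeff (Abs_series ?f :: ('m, 'r, 'v) series) = ?f"
    by (rule coeff_Abs_series) (use assms in \<open>auto simp: summable_family_def\<close>)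
  then show ?thesis unfolding family_sum_def by simp
qed

text \<open>
  In a summable family every nonzero member contains a monomial, and every monomial lies in
  finitely many members; so the set of nonzero members can always be indexed by a subset of
  \<open>'m \<times> nat\<close>. Quantifying over this single index type therefore loses no generality.
\<close>

definition strongly_linear ::
    "(('m::linordered_ab_group_add, 'r::linordered_field, 'v::infinite) series \<Rightarrow>
      ('m, 'r, 'v) series) \<Rightarrow> bool" where
  "strongly_linear L \<longleftrightarrow>
    (\<forall>s t. L (s + t) = L s + L t) \<and>
    (\<forall>r s. L (const r * s) = const r * L s) \<and>
    (\<forall>(I :: ('m \<times> nat) set) s. summable_family I s \<longrightarrow>
      has_family_sum I (\<lambda>i. L (s i)) (L (family_sum I s)))"


section \<open>Logarithms, derivations and compositions\<close>

text \<open>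
  The values of \<open>Log\<close> outside the positive series, and of \<open>cmp f s\<close> for \<open>s\<close> not in
  \<^const>\<open>pos_infinite\<close>, are never used.
\<close>

definition exp_closed_transserial_field ::
    "(('m::linordered_ab_group_add, 'r::linordered_field, 'v::infinite) series \<Rightarrow>
      ('m, 'r, 'v) series) \<Rightarrow> bool" where
  "exp_closed_transserial_field Log \<longleftrightarrow>
    bij_betw Log {0<..} UNIV \<and>
    (\<forall>s>0. \<forall>t>0. Log (s * t) = Log s + Log t) \<and>
    strict_mono_on {0<..} Log \<and>
    (\<forall>m. \<forall>n\<in>supp (Log (monomial m)). 0 < n) \<and>
    (\<forall>s>0. Log s \<le> s - 1) \<and>
    (\<forall>\<epsilon>. \<epsilon> \<prec> 1 \<longrightarrow>
      has_family_sum {1..} (\<lambda>k. const ((-1) ^ (k + 1) / of_nat k) * \<epsilon> ^ k) (Log (1 + \<epsilon>))) \<and>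
    bij_betw Log (const ` {0<..}) (range const)"

definition exp_less ::
    "(('m::linordered_ab_group_add, 'r::linordered_field, 'v::infinite) series \<Rightarrow>
      ('m, 'r, 'v) series) \<Rightarrow>
      ('m, 'r, 'v) series \<Rightarrow>
      ('m, 'r, 'v) series \<Rightarrow> bool" where
  "exp_less Log s t \<longleftrightarrow> Log \<bar>s\<bar> \<prec> Log \<bar>t\<bar>"

definition exp_le ::
    "(('m::linordered_ab_group_add, 'r::linordered_field, 'v::infinite) series \<Rightarrow>
      ('m, 'r, 'v) series) \<Rightarrow>
      ('m, 'r, 'v) series \<Rightarrow>
      ('m, 'r, 'v) series \<Rightarrow> bool" where
  "exp_le Log s t \<longleftrightarrow> Log \<bar>s\<bar> \<preceq> Log \<bar>t\<bar>"

text \<open>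
  The last clause is \<open>D (Log \<bar>s\<bar>) = D s / s\<close>; the series type carries no division symbol.
\<close>

definition transserial_derivation ::
    "(('m::linordered_ab_group_add, 'r::linordered_field, 'v::infinite) series \<Rightarrow>
      ('m, 'r, 'v) series) \<Rightarrow>
      (('m, 'r, 'v) series \<Rightarrow> ('m, 'r, 'v) series) \<Rightarrow> bool" where
  "transserial_derivation Log D \<longleftrightarrow>
    strongly_linear D \<and>
    (\<forall>s t. D (s * t) = D s * t + s * D t) \<and>
    (\<forall>s. s \<noteq> 0 \<longrightarrow> s * D (Log \<bar>s\<bar>) = D s)"

definition derivation_identity ::
    "(('m::linordered_ab_group_add, 'r::linordered_field, 'v::infinite) series \<Rightarrow>
      ('m, 'r, 'v) series) \<Rightarrow>
      ('m, 'r, 'v) series \<Rightarrow> bool" where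
  "derivation_identity D x \<longleftrightarrow> x \<in> range monomial \<and> 0 < x \<and> x \<noteq> 1 \<and> D x = 1"

definition flat_derivation ::
    "(('m::linordered_ab_group_add, 'r::linordered_field, 'v::infinite) series \<Rightarrow>
      ('m, 'r, 'v) series) \<Rightarrow>
      (('m, 'r, 'v) series \<Rightarrow> ('m, 'r, 'v) series) \<Rightarrow>
      ('m, 'r, 'v) series \<Rightarrow> bool" where
  "flat_derivation Log D x \<longleftrightarrow>
    (\<forall>m. \<forall>n\<in>supp (D (monomial m)). \<exists>f w.
      exp_less Log (monomial f) (monomial m) \<and>
      exp_le Log (monomial w) x \<and>
      n = m + f + w)"

definition H_field ::
    "(('m::linordered_ab_group_add, 'r::linordered_field, 'v::infinite) series \<Rightarrow>
      ('m, 'r, 'v) series) \<Rightarrow> bool" where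
  "H_field D \<longleftrightarrow> {f. D f = 0} = range const \<and> (\<forall>f\<in>pos_infinite. 0 < D f)"

definition transserial_composition ::
    "(('m::linordered_ab_group_add, 'r::linordered_field, 'v::infinite) series \<Rightarrow>
      ('m, 'r, 'v) series) \<Rightarrow>
      (('m, 'r, 'v) series \<Rightarrow> ('m, 'r, 'v) series \<Rightarrow> ('m, 'r, 'v) series) \<Rightarrow> bool" where
  "transserial_composition Log cmp \<longleftrightarrow>
    (\<forall>s\<in>pos_infinite.
      strongly_linear (\<lambda>f. cmp f s) \<and>
      cmp 1 s = 1 \<and>
      (\<forall>f g. cmp (f * g) s = cmp f s * cmp g s) \<and>
      mono (\<lambda>f. cmp f s) \<and>
      (\<forall>f>0. cmp (Log f) s = Log (cmp f s))) \<and>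
    (\<forall>f. \<forall>s\<in>pos_infinite. \<forall>t\<in>pos_infinite. cmp f (cmp s t) = cmp (cmp f s) t)"

definition composition_identity ::
    "(('m::linordered_ab_group_add, 'r::linordered_field, 'v::infinite) series \<Rightarrow>
      ('m, 'r, 'v) series \<Rightarrow> ('m, 'r, 'v) series) \<Rightarrow>
      ('m, 'r, 'v) series \<Rightarrow> bool" where
  "composition_identity cmp x \<longleftrightarrow> (\<forall>s\<in>pos_infinite. cmp x s = s) \<and> (\<forall>f. cmp f x = f)"

definition flat_composition ::
    "(('m::linordered_ab_group_add, 'r::linordered_field, 'v::infinite) series \<Rightarrow>
      ('m, 'r, 'v) series) \<Rightarrow>
      (('m, 'r, 'v) series \<Rightarrow> ('m, 'r, 'v) series \<Rightarrow> ('m, 'r, 'v) series) \<Rightarrow> bool" where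
  "flat_composition Log cmp \<longleftrightarrow>
    (\<forall>s\<in>pos_infinite. \<forall>m. m \<noteq> 0 \<longrightarrow> (\<forall>n\<in>supp (cmp (monomial m) s).
      \<exists>f w. \<exists>u\<in>supp s.
        exp_less Log (monomial f) (monomial m) \<and>
        (monomial w :: ('m, 'r, 'v) series) \<preceq> 1 \<and>
        exp_le Log (monomial w) (monomial u) \<and>
        n = dominant (cmp (monomial m) s) + f + w))"

definition chain_rule ::
    "(('m::linordered_ab_group_add, 'r::linordered_field, 'v::infinite) series \<Rightarrow>
      ('m, 'r, 'v) series) \<Rightarrow>
      (('m, 'r, 'v) series \<Rightarrow> ('m, 'r, 'v) series \<Rightarrow> ('m, 'r, 'v) series) \<Rightarrow> bool" where
  "chain_rule D cmp \<longleftrightarrow> (\<forall>f. \<forall>s\<in>pos_infinite. D (cmp f s) = D s * cmp (D f) s)"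

definition taylor_expansions ::
    "(('m::linordered_ab_group_add, 'r::linordered_field, 'v::infinite) series \<Rightarrow>
      ('m, 'r, 'v) series) \<Rightarrow>
      (('m, 'r, 'v) series \<Rightarrow> ('m, 'r, 'v) series \<Rightarrow> ('m, 'r, 'v) series) \<Rightarrow> bool" where
  "taylor_expansions D cmp \<longleftrightarrow>
    (\<forall>f. \<forall>s\<in>pos_infinite. \<forall>\<delta>.
      \<delta> \<prec> s \<longrightarrow>
      (\<forall>m\<in>supp f. cmp (D (monomial m)) s * \<delta> \<prec> cmp (monomial m) s) \<longrightarrow>
      summable_family (supp f \<times> UNIV) (\<lambda>(m, k). cmp ((D ^^ k) (monomial m)) s * \<delta> ^ k) \<and>
      has_family_sum UNIV (\<lambda>k. const (1 / fact k) * cmp ((D ^^ k) f) s * \<delta> ^ k)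
        (cmp f (s + \<delta>)) \<and>
      has_family_sum (supp f \<times> UNIV)
        (\<lambda>(m, k). const (coeff f m / fact k) * cmp ((D ^^ k) (monomial m)) s * \<delta> ^ k)
        (cmp f (s + \<delta>)) \<and>
      (\<forall>k. cmp ((D ^^ k) f) s * \<delta> ^ k \<noteq> 0 \<longrightarrow>
        cmp ((D ^^ Suc k) f) s * \<delta> ^ Suc k \<prec> cmp ((D ^^ k) f) s * \<delta> ^ k))"

definition monotone_composition ::
    "(('m::linordered_ab_group_add, 'r::linordered_field, 'v::infinite) series \<Rightarrow>
      ('m, 'r, 'v) series) \<Rightarrow>
      (('m, 'r, 'v) series \<Rightarrow> ('m, 'r, 'v) series \<Rightarrow> ('m, 'r, 'v) series) \<Rightarrow> bool" where
  "monotone_composition D cmp \<longleftrightarrow>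
    (\<forall>f. f \<notin> range const \<longrightarrow>
      (0 < D f \<longrightarrow> strict_mono_on pos_infinite (cmp f)) \<and>
      (D f < 0 \<longrightarrow> strict_antimono_on pos_infinite (cmp f)))"

definition composition_group ::
    "(('m::linordered_ab_group_add, 'r::linordered_field, 'v::infinite) series \<Rightarrow>
      ('m, 'r, 'v) series \<Rightarrow> ('m, 'r, 'v) series) \<Rightarrow>
      ('m, 'r, 'v) series \<Rightarrow> ('m, 'r, 'v) series monoid" where
  "composition_group cmp x = \<lparr>carrier = pos_infinite, mult = cmp, one = x\<rparr>"

definition conjugate :: "('a, 'b) monoid_scheme \<Rightarrow> 'a \<Rightarrow> 'a \<Rightarrow> bool" where
  "conjugate G f g \<longleftrightarrow> (\<exists>h\<in>carrier G. h \<otimes>\<^bsub>G\<^esub> f = g \<otimes>\<^bsub>G\<^esub> h)"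

definition centralizer :: "('a, 'b) monoid_scheme \<Rightarrow> 'a \<Rightarrow> 'a set" where
  "centralizer G f = {h \<in> carrier G. h \<otimes>\<^bsub>G\<^esub> f = f \<otimes>\<^bsub>G\<^esub> h}"

end

theory Submission
  imports Defs
begin

text \<open>
  Every series above \<open>x\<close> is conjugate to the translation \<open>x + 1\<close>. Composition of positive infinite
  series is strictly monotone in both arguments, so conjugation is an order-preserving
  automorphism of the group and both claims may be transported to the case \<open>g = x + 1\<close>
  (\<open>above_centralizer_less\<close> and \<open>centralizer_cofinal\<close>).

  A series \<open>p\<close> with \<open>p \<circ> (x + 1) = p\<close> is constant, because a nonconstant \<open>p\<close> has nonzero derivative
  and then \<open>s \<mapsto> p \<circ> s\<close> is strictly monotone. Hence the centralizer of \<open>x + 1\<close> consists of the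
  translations \<open>x + r\<close> with \<open>r\<close> constant (\<open>centralizer_translation\<close>).

  For the first claim, \<open>f\<close> exceeds all translations, so \<open>p = f - x\<close> is positive infinite, has positive
  derivative, and \<open>p \<circ> (x + 1) > p\<close>; adding \<open>x + 1\<close> gives \<open>f \<circ> (x + 1) > (x + 1) \<circ> f\<close>.

  For the second claim, let \<open>f \<ge> x + 1\<close> and let \<open>h\<close> conjugate \<open>f\<close> to \<open>x + 1\<close>, so that
  \<open>h \<circ> (x + 1) \<le> h \<circ> f = h + 1\<close>. The derivative of \<open>h\<close> is bounded by a constant: otherwise
  \<open>h - 2 x\<close> has positive derivative, and evaluating at \<open>x < x + 1\<close> gives \<open>h \<circ> (x + 1) > h + 2\<close>. If
  \<open>h' < c\<close>, then \<open>c x - h\<close> has positive derivative, and evaluating at \<open>x < x + q\<close> gives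
  \<open>h \<circ> (x + q) < h + c q\<close> for every constant \<open>q > 0\<close>. So \<open>x + q\<close> lies below the conjugate of
  \<open>x + c q\<close> by \<open>h\<close>, which centralizes \<open>f\<close>. Arguing with derivatives rather than with iterates of
  \<open>f\<close> makes this work for constant fields that are not archimedean.
\<close>

section \<open>Constant series\<close>

lemma const_one [simp]: "const 1 = 1"
  by (rule series_eqI) (simp add: coeff_const coeff_one)

lemma const_add: "const (r + s) = const r + const s"
  by (rule series_eqI) (simp add: coeff_const coeff_add)

lemma const_diff: "const (r - s) = const r - const s"
  by (rule series_eqI) (simp add: coeff_const coeff_diff)

lemma const_mult:
  "(const (r * s) :: ('m::linordered_ab_group_add, 'r::linordered_field, 'v::infinite) series) =
    const r * const s"
proof (rule series_eqI)
  fix m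
  have "coeff (const r * const s :: ('m, 'r, 'v) series) m =
      (\<Sum>(a, b) | a \<in> {0} \<and> b \<in> {0} \<and> a + b = m. coeff (const r :: ('m, 'r, 'v) series) a *
        coeff (const s :: ('m, 'r, 'v) series) b)"
    by (rule coeff_mult) (auto simp: supp_def coeff_const well_based_singleton split: if_splits)
  also have "{(a, b). a \<in> {0} \<and> b \<in> {0} \<and> a + b = m} = (if m = 0 then {(0, 0)} else {})"
    by auto
  finally show "coeff (const (r * s) :: ('m, 'r, 'v) series) m =
      coeff (const r * const s :: ('m, 'r, 'v) series) m"
    by (simp add: coeff_const)
qed

lemma const_pos:
  fixes r :: "'r::linordered_field"
  assumes "0 < r"
  shows "0 < (const r :: ('m::linordered_ab_group_add, 'r, 'v::infinite) series)"
proof -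
  let ?c = "const r :: ('m, 'r, 'v) series"
  have "dominant ?c = 0"
    using assms by (intro dominant_unique) (auto simp: supp_def coeff_const split: if_splits)
  moreover have "?c \<noteq> 0"
    using assms by (metis coeff_const coeff_zero less_irrefl)
  ultimately show ?thesis
    using assms by (simp add: less_series_def pos_series_def coeff_const)
qed

lemma const_less:
  fixes r s :: "'r::linordered_field"
  assumes "r < s"
  shows "(const r :: ('m::linordered_ab_group_add, 'r, 'v::infinite) series) < const s"
proof -
  have "0 < (const (s - r) :: ('m, 'r, 'v) series)" using assms by (intro const_pos) simp
  then show ?thesis by (simp add: const_diff)
qed

lemma const_le:
  fixes r s :: "'r::linordered_field"
  assumes "r \<le> s"
  shows "(const r :: ('m::linordered_ab_group_add, 'r, 'v::infinite) series) \<le> const s"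
proof (cases "r = s")
  case False
  with assms have "r < s" by simp
  then show ?thesis by (rule less_imp_le[OF const_less])
qed simp

lemma pos_infinite_add_const:
  assumes "s \<in> pos_infinite"
  shows "s + const r \<in> pos_infinite"
  unfolding pos_infinite_def
proof clarify
  fix q
  have "const (q - r) < s" using assms by (simp add: pos_infinite_def)
  then show "const q < s + const r" by (simp add: const_diff algebra_simps)
qed

section \<open>Conjugation and centralizers in groups\<close>

lemma (in group) inv_intertwines:
  assumes "k \<in> carrier G" "f \<in> carrier G" "g \<in> carrier G" "k \<otimes> f = g \<otimes> k"
  shows "inv k \<otimes> g = f \<otimes> inv k"
  using assms by (metis inv_closed inv_solve_left inv_solve_right m_assoc m_closed)

lemma (in group) centralizer_transport:
  assumes "k \<in> carrier G" "f \<in> carrier G" "g \<in> carrier G"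
    and conj: "k \<otimes> f = g \<otimes> k" and h: "h \<in> centralizer G f"
  shows "k \<otimes> h \<otimes> inv k \<in> centralizer G g"
proof -
  have hc: "h \<in> carrier G" and comm: "h \<otimes> f = f \<otimes> h" using h by (auto simp: centralizer_def)
  have fk: "inv k \<otimes> g = f \<otimes> inv k"
    by (rule inv_intertwines) fact+
  have "k \<otimes> h \<otimes> inv k \<otimes> g = k \<otimes> (h \<otimes> f) \<otimes> inv k"
    using assms(1-3) hc fk by (simp add: m_assoc)
  also have "\<dots> = k \<otimes> f \<otimes> h \<otimes> inv k"
    using assms(1-3) hc comm by (simp add: m_assoc)
  also have "\<dots> = g \<otimes> (k \<otimes> h \<otimes> inv k)"
    using assms(1-3) hc conj by (simp add: m_assoc)
  finally show ?thesis using assms hc by (simp add: centralizer_def)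
qed

section \<open>Ordered groups of positive infinite series\<close>

text \<open>
  The positive infinite series under a composition law for which they form a group, together with
  a derivation whose sign on \<open>f\<close> decides whether \<open>s \<mapsto> f \<circ> s\<close> is increasing or decreasing.
\<close>

locale monotone_composition_group =
  fixes Log D :: "('m::linordered_ab_group_add, 'r::linordered_field, 'v::infinite) series
      \<Rightarrow> ('m, 'r, 'v) series"
    and cmp :: "('m, 'r, 'v) series \<Rightarrow> ('m, 'r, 'v) series \<Rightarrow> ('m, 'r, 'v) series"
    and x :: "('m, 'r, 'v) series"
  assumes linear_D: "strongly_linear D"
    and D_x: "D x = 1"
    and H_field: "H_field D"
    and composition: "transserial_composition Log cmp"
    and identity: "composition_identity cmp x"
    and group_cmp: "group (composition_group cmp x)"
    and monotone: "monotone_composition D cmp"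
begin

abbreviation G :: "('m, 'r, 'v) series monoid" where "G \<equiv> composition_group cmp x"

sublocale group G by (rule group_cmp)

lemma carrier_G [simp]: "carrier G = pos_infinite"
  and mult_G [simp]: "f \<otimes>\<^bsub>G\<^esub> g = cmp f g"
  and one_G [simp]: "\<one>\<^bsub>G\<^esub> = x"
  by (simp_all add: composition_group_def)

lemma x_pos_infinite [simp]: "x \<in> pos_infinite"
  using one_closed by simp

lemma cmp_closed [simp]: "f \<in> pos_infinite \<Longrightarrow> g \<in> pos_infinite \<Longrightarrow> cmp f g \<in> pos_infinite"
  using m_closed by simp

lemma inv_pos_infinite [simp]: "f \<in> pos_infinite \<Longrightarrow> inv\<^bsub>G\<^esub> f \<in> pos_infinite"
  using inv_closed by simp

lemma cmp_assoc:
  "s \<in> pos_infinite \<Longrightarrow> t \<in> pos_infinite \<Longrightarrow> cmp (cmp f s) t = cmp f (cmp s t)"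
  using composition by (simp add: transserial_composition_def)

lemma cmp_inv [simp]:
  assumes "f \<in> pos_infinite"
  shows "cmp f (inv\<^bsub>G\<^esub> f) = x" "cmp (inv\<^bsub>G\<^esub> f) f = x"
  using r_inv[of f] l_inv[of f] assms by simp_all

lemma cmp_x [simp]: "cmp f x = f"
  and x_cmp [simp]: "s \<in> pos_infinite \<Longrightarrow> cmp x s = s"
  using identity by (simp_all add: composition_identity_def)

lemma translation_pos_infinite [simp]: "x + const r \<in> pos_infinite"
  by (rule pos_infinite_add_const) simp

lemma cmp_add: "s \<in> pos_infinite \<Longrightarrow> cmp (f + g) s = cmp f s + cmp g s"
  using composition unfolding transserial_composition_def strongly_linear_def by blast

lemma cmp_scale: "s \<in> pos_infinite \<Longrightarrow> cmp (const r * f) s = const r * cmp f s"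
  using composition unfolding transserial_composition_def strongly_linear_def by blast

lemma cmp_diff: "s \<in> pos_infinite \<Longrightarrow> cmp (f - g) s = cmp f s - cmp g s"
  using cmp_add[of s "f - g" g] by (simp add: algebra_simps)

lemma cmp_const:
  assumes "s \<in> pos_infinite"
  shows "cmp (const r) s = const r"
proof -
  have "cmp 1 s = 1" using composition assms by (simp add: transserial_composition_def)
  then show ?thesis using cmp_scale[OF assms, of r 1] by simp
qed

lemma translation_cmp: "s \<in> pos_infinite \<Longrightarrow> cmp (x + const r) s = s + const r"
  by (simp add: cmp_add cmp_const)

lemma D_add: "D (f + g) = D f + D g"
  using linear_D by (simp add: strongly_linear_def)

lemma D_diff: "D (f - g) = D f - D g"
  using D_add[of "f - g" g] by (simp add: algebra_simps)

lemma D_scale: "D (const r * f) = const r * D f"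
  using linear_D unfolding strongly_linear_def by blast

lemma D_eq_0_iff: "D f = 0 \<longleftrightarrow> f \<in> range const"
  using H_field by (auto simp: H_field_def)

lemma D_pos_infinite: "f \<in> pos_infinite \<Longrightarrow> 0 < D f"
  using H_field by (simp add: H_field_def)

lemma cmp_strict_mono:
  assumes "0 < D f" "s \<in> pos_infinite" "t \<in> pos_infinite" "s < t"
  shows "cmp f s < cmp f t"
proof -
  have "f \<notin> range const" using assms(1) D_eq_0_iff[of f] by auto
  then have "strict_mono_on pos_infinite (cmp f)"
    using monotone assms(1) by (simp add: monotone_composition_def)
  then show ?thesis using assms by (meson strict_mono_onD)
qed

lemma cmp_strict_antimono:
  assumes "D f < 0" "s \<in> pos_infinite" "t \<in> pos_infinite" "s < t"
  shows "cmp f t < cmp f s"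
proof -
  have "0 < D (- f)" using assms(1) D_diff[of 0 f] D_diff[of 0 0] by simp
  from cmp_strict_mono[OF this assms(2-4)] show ?thesis
    using cmp_diff[of _ 0 f] cmp_diff[of _ 0 0] assms(2,3) by simp
qed

lemma cmp_less_iff_right:
  assumes "f \<in> pos_infinite" "s \<in> pos_infinite" "t \<in> pos_infinite"
  shows "cmp f s < cmp f t \<longleftrightarrow> s < t"
  using cmp_strict_mono[OF D_pos_infinite[OF assms(1)]] assms(2,3)
  by (metis less_asym less_linear)

lemma cmp_less_iff_left:
  assumes "f \<in> pos_infinite" "s \<in> pos_infinite" "t \<in> pos_infinite"
  shows "cmp s f < cmp t f \<longleftrightarrow> s < t"
proof -
  have mono: "cmp a f \<le> cmp b f" if "a \<le> b" for a b
    using composition assms(1) that by (auto simp: transserial_composition_def mono_def)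
  have "cmp s f \<noteq> cmp t f" if "s \<noteq> t"
    using that right_cancel[of f s t] assms by simp
  then show ?thesis using mono[of s t] mono[of t s] by (metis less_le not_le)
qed

section \<open>Comparison with translations\<close>

lemma invariant_imp_const:
  assumes "s \<in> pos_infinite" "x < s" "cmp p s = p"
  shows "p \<in> range const"
proof (rule ccontr)
  assume "p \<notin> range const"
  then have "D p \<noteq> 0" by (simp add: D_eq_0_iff)
  then show False
    using cmp_strict_mono[of p x s] cmp_strict_antimono[of p x s] assms
    by (cases "D p" "0 :: ('m, 'r, 'v) series" rule: linorder_cases) auto
qed

lemma centralizer_translation: "centralizer G (x + 1) = range (\<lambda>r. x + const r)"
proof (intro equalityI subsetI)
  have x1: "x + 1 \<in> pos_infinite" using translation_pos_infinite[of 1] by simp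
  {
    fix h assume "h \<in> centralizer G (x + 1)"
    then have h: "h \<in> pos_infinite" "cmp h (x + 1) = h + 1"
      using translation_cmp[of h 1] by (auto simp: centralizer_def)
    have "cmp (h - x) (x + 1) = h - x" using h x1 by (simp add: cmp_diff)
    then obtain r where "h - x = const r" using invariant_imp_const[OF x1] by auto
    then show "h \<in> range (\<lambda>r. x + const r)" by (metis add.commute diff_add_cancel rangeI)
  next
    fix h assume "h \<in> range (\<lambda>r. x + const r)"
    then obtain r where r: "h = x + const r" by blast
    have "cmp h (x + 1) = cmp (x + 1) h"
      using translation_cmp[OF x1, of r] translation_cmp[of h 1] r by (simp add: algebra_simps)
    then show "h \<in> centralizer G (x + 1)" using r by (simp add: centralizer_def)
  }
qed

lemma above_translations_less:
  assumes "f \<in> pos_infinite" "\<And>r. x + const r < f"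
  shows "cmp (x + 1) f < cmp f (x + 1)"
proof -
  have x1: "x + 1 \<in> pos_infinite" using translation_pos_infinite[of 1] by simp
  have "f - x \<in> pos_infinite"
    using assms(2) by (auto simp: pos_infinite_def algebra_simps)
  then have "f - x < cmp (f - x) (x + 1)"
    using cmp_strict_mono[OF D_pos_infinite, of "f - x" x "x + 1"] x1 by simp
  then show ?thesis
    using translation_cmp[OF assms(1), of 1] x1 by (simp add: cmp_diff algebra_simps)
qed

text \<open>
  The derivative of \<open>h\<close> is bounded by a constant \<open>c\<close> as soon as \<open>h\<close> grows by at most \<open>1\<close> from \<open>x\<close>
  to \<open>x + 1\<close>; the bound then controls the growth of \<open>h\<close> under every positive translation.
\<close>

lemma translation_growth_bounded:
  assumes h: "h \<in> pos_infinite" and le: "cmp h (x + 1) \<le> h + 1"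
  obtains c where "\<And>q. 0 < q \<Longrightarrow> cmp h (x + const q) < h + const (c * q)"
proof -
  have x1: "x + 1 \<in> pos_infinite" using translation_pos_infinite[of 1] by simp
  have "\<exists>c. D h < const c"
  proof (rule ccontr)
    assume "\<not> ?thesis"
    \<comment> \<open>A bound above \<open>2\<close> makes the derivative of \<open>h - 2 x\<close> positive.\<close>
    then have "const 3 \<le> D h" by (simp add: not_less)
    moreover have "const 2 < (const 3 :: ('m, 'r, 'v) series)" by (rule const_less) simp
    ultimately have "0 < D (h - const 2 * x)" by (simp add: D_diff D_scale D_x)
    from cmp_strict_mono[OF this, of x "x + 1"] have "h + const 2 < cmp h (x + 1)"
      using x1 by (simp add: cmp_diff cmp_scale distrib_left)
    moreover have "const 1 < (const 2 :: ('m, 'r, 'v) series)" by (rule const_less) simp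
    ultimately show False using le by simp
  qed
  then obtain c where c: "D h < const c" by blast
  have "cmp h (x + const q) < h + const (c * q)" if "0 < q" for q :: 'r
  proof -
    have "0 < D (const c * x - h)" using c by (simp add: D_diff D_scale D_x)
    moreover have "0 < (const q :: ('m, 'r, 'v) series)" using that by (rule const_pos)
    ultimately have "cmp (const c * x - h) x < cmp (const c * x - h) (x + const q)"
      by (intro cmp_strict_mono) simp_all
    then show ?thesis by (simp add: cmp_diff cmp_scale const_mult distrib_left add.commute)
  qed
  then show thesis by (rule that)
qed

text \<open>
  If \<open>h\<close> conjugates \<open>f\<close> to \<open>x + 1\<close>, the centralizer of \<open>f\<close> consists of the series that \<open>h\<close>
  conjugates to translations. For \<open>q > 0\<close>, the one conjugated to \<open>x + c q\<close> exceeds \<open>x + q\<close>, because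
  its image under \<open>h\<close> is \<open>h + c q\<close>, which exceeds \<open>h \<circ> (x + q)\<close>.
\<close>

lemma translation_below_centralizer:
  assumes f: "f \<in> pos_infinite" "x + 1 \<le> f" and conj: "conjugate G f (x + 1)"
  shows "\<exists>f0\<in>centralizer G f. x + const r \<le> f0"
proof -
  obtain h where h: "h \<in> pos_infinite" "cmp h f = cmp (x + 1) h"
    using conj by (auto simp: conjugate_def)
  let ?i = "inv\<^bsub>G\<^esub> h"
  have x1: "x + 1 \<in> pos_infinite" using translation_pos_infinite[of 1] by simp
  have hf: "cmp h f = h + 1" using h translation_cmp[of h 1] by simp
  have "cmp h (x + 1) \<le> h + 1"
    using cmp_less_iff_right[OF h(1) f(1) x1] f(2) by (simp add: hf not_less[symmetric])
  then obtain c where c: "\<And>q. 0 < q \<Longrightarrow> cmp h (x + const q) < h + const (c * q)"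
    using translation_growth_bounded h(1) by blast
  \<comment> \<open>The growth bound needs a positive shift, and \<open>r\<close> may be negative.\<close>
  define q where "q = max r 1"
  define t where "t = x + const (c * q)"
  define f0 where "f0 = cmp (cmp ?i t) h"
  have t: "t \<in> pos_infinite" "t \<in> centralizer G (x + 1)"
    by (auto simp: t_def centralizer_translation)
  have "cmp ?i (x + 1) = cmp f ?i"
    using inv_intertwines[of h f "x + 1"] h f x1 by simp
  then have f0: "f0 \<in> centralizer G f"
    using centralizer_transport[of ?i "x + 1" f t] h(1) f(1) x1 t by (simp add: f0_def)
  have "cmp h f0 = cmp (cmp (cmp h ?i) t) h"
    using h(1) t(1) by (simp add: f0_def cmp_assoc del: cmp_inv)
  also have "\<dots> = h + const (c * q)" using h(1) t by (simp add: t_def translation_cmp)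
  finally have "cmp h (x + const q) < cmp h f0" using c[of q] by (simp add: q_def)
  then have "x + const q < f0"
    using h(1) t(1) by (subst (asm) cmp_less_iff_right) (simp_all add: f0_def)
  moreover have "x + const r \<le> x + const q" by (simp add: q_def const_le)
  ultimately have "x + const r \<le> f0" by simp
  then show ?thesis using f0 by (rule bexI)
qed

section \<open>Transport along conjugation\<close>

lemma conjugate_translation_obtain:
  assumes "conjugate G g (x + 1)" "g \<in> pos_infinite"
  obtains k where "k \<in> pos_infinite" "cmp k g = cmp (x + 1) k"
    "cmp (inv\<^bsub>G\<^esub> k) (x + 1) = cmp g (inv\<^bsub>G\<^esub> k)"
proof -
  obtain k where "k \<in> pos_infinite" "cmp k g = cmp (x + 1) k"
    using assms by (auto simp: conjugate_def)
  moreover from this have "cmp (inv\<^bsub>G\<^esub> k) (x + 1) = cmp g (inv\<^bsub>G\<^esub> k)"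
    using inv_intertwines[of k g "x + 1"] assms translation_pos_infinite[of 1] by simp
  ultimately show thesis by (rule that)
qed

lemma above_centralizer_less:
  assumes f: "f \<in> pos_infinite" and g: "g \<in> pos_infinite" "conjugate G g (x + 1)"
    and above: "\<And>h. h \<in> centralizer G g \<Longrightarrow> h < f"
  shows "cmp g f < cmp f g"
proof -
  have x1: "x + 1 \<in> pos_infinite" using translation_pos_infinite[of 1] by simp
  obtain k where k: "k \<in> pos_infinite" "cmp k g = cmp (x + 1) k"
    "cmp (inv\<^bsub>G\<^esub> k) (x + 1) = cmp g (inv\<^bsub>G\<^esub> k)"
    using conjugate_translation_obtain g by blast
  let ?i = "inv\<^bsub>G\<^esub> k"
  \<comment> \<open>The conjugate of \<open>f\<close> under the conjugation that sends \<open>g\<close> to \<open>x + 1\<close>.\<close>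
  define f1 where "f1 = cmp (cmp k f) ?i"
  have f1: "f1 \<in> pos_infinite" "cmp f1 k = cmp k f"
    using f k(1) by (simp_all add: f1_def cmp_assoc)
  have "x + const r < f1" for r
  proof -
    let ?t = "x + const r"
    have "?t \<in> centralizer G (x + 1)" by (simp add: centralizer_translation)
    then have "cmp (cmp ?i ?t) k < f"
      using centralizer_transport[of ?i "x + 1" g ?t] k x1 g(1) above by simp
    then have "cmp k (cmp (cmp ?i ?t) k) < cmp k f"
      using f k(1) by (simp add: cmp_less_iff_right)
    moreover have "cmp k (cmp (cmp ?i ?t) k) = cmp (cmp (cmp k ?i) ?t) k"
      using k(1) by (simp add: cmp_assoc del: cmp_inv)
    ultimately have "cmp ?t k < cmp f1 k" using k(1) f1 by simp
    then show ?thesis using k(1) f1(1) by (subst (asm) cmp_less_iff_left) simp_all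
  qed
  from above_translations_less[OF f1(1) this]
  have "cmp (cmp (x + 1) f1) k < cmp (cmp f1 (x + 1)) k"
    using f1(1) k(1) x1 by (simp add: cmp_less_iff_left)
  moreover have "cmp (cmp (x + 1) f1) k = cmp k (cmp g f)"
  proof -
    have "cmp (cmp (x + 1) f1) k = cmp (x + 1) (cmp k f)"
      using f1 k(1) by (simp add: cmp_assoc)
    also have "\<dots> = cmp (cmp k g) f" using f k(1) by (simp add: cmp_assoc k(2))
    also have "\<dots> = cmp k (cmp g f)" using f g(1) by (simp add: cmp_assoc)
    finally show ?thesis .
  qed
  moreover have "cmp (cmp f1 (x + 1)) k = cmp k (cmp f g)"
  proof -
    have "cmp (cmp f1 (x + 1)) k = cmp f1 (cmp k g)"
      using x1 k(1) by (simp add: cmp_assoc k(2))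
    also have "\<dots> = cmp (cmp f1 k) g" using g(1) k(1) by (simp add: cmp_assoc)
    also have "\<dots> = cmp k (cmp f g)" using f g(1) f1 by (simp add: cmp_assoc)
    finally show ?thesis .
  qed
  ultimately show ?thesis using f g(1) k(1) by (simp add: cmp_less_iff_right)
qed

lemma centralizer_cofinal:
  assumes f: "f \<in> pos_infinite" "conjugate G f (x + 1)"
    and g: "g \<in> pos_infinite" "conjugate G g (x + 1)"
    and le: "g \<le> f" and g0: "g0 \<in> centralizer G g"
  shows "\<exists>f0\<in>centralizer G f. g0 \<le> f0"
proof -
  have x1: "x + 1 \<in> pos_infinite" using translation_pos_infinite[of 1] by simp
  obtain k where k: "k \<in> pos_infinite" "cmp k g = cmp (x + 1) k"
    using conjugate_translation_obtain g by blast
  let ?i = "inv\<^bsub>G\<^esub> k"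
  have g0c: "g0 \<in> pos_infinite" using g0 by (simp add: centralizer_def)
  define f1 where "f1 = cmp (cmp k f) ?i"
  have f1: "f1 \<in> pos_infinite" "cmp f1 k = cmp k f"
    using f k(1) by (simp_all add: f1_def cmp_assoc)
  have inv_f1: "cmp ?i f1 = cmp f ?i"
    using inv_intertwines[of k f f1] k(1) f(1) f1 by simp
  have "cmp (x + 1) k \<le> cmp f1 k"
    using le cmp_less_iff_right[OF k(1) f(1) g(1)] by (simp add: f1 k(2)[symmetric] not_less[symmetric])
  then have "x + 1 \<le> f1"
    using cmp_less_iff_left[OF k(1) f1(1) x1] by (simp add: not_less[symmetric])
  moreover have "conjugate G f1 (x + 1)"
  proof -
    obtain h where h: "h \<in> pos_infinite" "cmp h f = cmp (x + 1) h"
      using conjugate_translation_obtain f by blast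
    have "cmp (cmp h ?i) f1 = cmp h (cmp f ?i)"
      using k(1) f1(1) by (simp add: cmp_assoc inv_f1)
    also have "\<dots> = cmp (cmp (x + 1) h) ?i"
      using k(1) f(1) h(2) by (simp add: cmp_assoc flip: h(2))
    also have "\<dots> = cmp (x + 1) (cmp h ?i)" using k(1) h(1) by (simp add: cmp_assoc)
    finally have "cmp (cmp h ?i) f1 = cmp (x + 1) (cmp h ?i)" .
    then show ?thesis using h(1) k(1) by (auto simp: conjugate_def intro!: bexI[of _ "cmp h ?i"])
  qed
  moreover obtain r where r: "cmp (cmp k g0) ?i = x + const r"
    using centralizer_transport[of k g "x + 1" g0] k g(1) g0 x1
    by (auto simp: centralizer_translation)
  ultimately obtain u where u: "u \<in> centralizer G f1" "cmp (cmp k g0) ?i \<le> u"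
    using translation_below_centralizer[OF f1(1), of r] by auto
  have uc: "u \<in> pos_infinite" using u(1) by (simp add: centralizer_def)
  define f0 where "f0 = cmp (cmp ?i u) k"
  have f0: "f0 \<in> centralizer G f"
    using centralizer_transport[of ?i f1 f u] k(1) f(1) f1(1) inv_f1 u(1) by (simp add: f0_def)
  have "cmp k f0 = cmp (cmp (cmp k ?i) u) k"
    using k(1) uc by (simp add: f0_def cmp_assoc del: cmp_inv)
  then have kf0: "cmp k f0 = cmp u k" using k(1) uc by simp
  have "cmp (cmp (cmp k g0) ?i) k = cmp k g0" using k(1) g0c by (simp add: cmp_assoc)
  then have "cmp k g0 \<le> cmp k f0"
    using cmp_less_iff_left[OF k(1) uc, of "cmp (cmp k g0) ?i"] u(2) k(1) g0c kf0
    by (simp add: not_less[symmetric])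
  then have "g0 \<le> f0"
    using cmp_less_iff_right[OF k(1), of f0 g0] f0 g0c
    by (simp add: not_less[symmetric] centralizer_def)
  then show ?thesis using f0 by blast
qed

end

theorem proposition5:
  fixes Log D :: "('m::linordered_ab_group_add, 'r::linordered_field, 'v::infinite) series
      \<Rightarrow> ('m, 'r, 'v) series"
    and cmp :: "('m, 'r, 'v) series \<Rightarrow> ('m, 'r, 'v) series \<Rightarrow> ('m, 'r, 'v) series"
    and x :: "('m, 'r, 'v) series"
  assumes "set_universe TYPE('v)"
    and "exp_closed_transserial_field Log"
    and "transserial_derivation Log D" and "surj D"
    and "derivation_identity D x" and "flat_derivation Log D x"
    and "H_field D"
    and "transserial_composition Log cmp" and "composition_identity cmp x"
    and "flat_composition Log cmp"
    and "chain_rule D cmp" and "taylor_expansions D cmp"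
    and "group (composition_group cmp x)"
    and "monotone_composition D cmp"
    and "\<And>f g. f \<in> pos_infinite \<Longrightarrow> g \<in> pos_infinite \<Longrightarrow> x < f \<Longrightarrow> x < g
      \<Longrightarrow> conjugate (composition_group cmp x) f g"
  shows "\<forall>f\<in>pos_infinite. \<forall>g\<in>pos_infinite. x < f \<longrightarrow> x < g \<longrightarrow>
    ((\<forall>h\<in>centralizer (composition_group cmp x) g. h < f) \<longrightarrow> cmp g f < cmp f g) \<and>
    (g \<le> f \<longrightarrow> (\<forall>g0\<in>centralizer (composition_group cmp x) g.
      \<exists>f0\<in>centralizer (composition_group cmp x) f. g0 \<le> f0))"
proof -
  interpret monotone_composition_group Log D cmp x
    by (rule monotone_composition_group.intro)
      (use assms in \<open>simp_all add: transserial_derivation_def derivation_identity_def\<close>)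
  have x1: "x + 1 \<in> pos_infinite" "x < x + 1"
    using translation_pos_infinite[of 1] by simp_all
  have "conjugate G u (x + 1)" if "u \<in> pos_infinite" "x < u" for u
    using assms(15) that x1 by blast
  then show ?thesis
    using above_centralizer_less centralizer_cofinal by simp
qed

end
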